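(* Let $q$ be a prime power and let $PSL(2,q)$ be the projective special linear group of degree $2$ over the finite field with $q$ elements. Then every nontrivial proper subgroup $H$ of $PSL(2,q)$ is an FF-subgroup of $PSL(2,q)$.
   Context: For a proper subgroup $H$ of a finite group $G$, let $\Delta_H(G)$ (the maximal cover of $H$ in $G$) denote the union, as a subset of $G$, of all maximal subgroups of $G$ containing $H$. The proper subgroup $H$ is called an FF-subgroup of $G$ if $\Delta_H(G)\neq G$. "Nontrivial" means different from the identity subgroup. *)

theory Defs
  imports
    "HOL-Analysis.Determinants"
    "HOL-Algebra.Coset"
    "HOL-Number_Theory.Prime_Powers"
begin

definition maximal_subgroup :: "'a set \<Rightarrow> ('a, 'b) monoid_scheme \<Rightarrow> bool" where
  "maximal_subgroup M G \<longleftrightarrow> subgroup M G \<and> M \<noteq> carrier G \<and>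
     (\<forall>K. subgroup K G \<longrightarrow> M \<subseteq> K \<longrightarrow> K = M \<or> K = carrier G)"

definition maximal_cover :: "('a, 'b) monoid_scheme \<Rightarrow> 'a set \<Rightarrow> 'a set" where
  "maximal_cover G H = \<Union>{M. maximal_subgroup M G \<and> H \<subseteq> M}"

definition FF_subgroup :: "'a set \<Rightarrow> ('a, 'b) monoid_scheme \<Rightarrow> bool" where
  "FF_subgroup H G \<longleftrightarrow>
     subgroup H G \<and> H \<noteq> carrier G \<and> maximal_cover G H \<noteq> carrier G"

definition group_center :: "('a, 'b) monoid_scheme \<Rightarrow> 'a set" where
  "group_center G = {z \<in> carrier G. \<forall>x \<in> carrier G. z \<otimes>\<^bsub>G\<^esub> x = x \<otimes>\<^bsub>G\<^esub> z}"

definition special_linear_group :: "('a::field ^ 'n ^ 'n) monoid" where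
  "special_linear_group = \<lparr>carrier = {A. det A = 1}, monoid.mult = (**), one = mat 1\<rparr>"

definition projective_special_linear_group :: "('a::field ^ 'n ^ 'n) set monoid" where
  "projective_special_linear_group =
     special_linear_group Mod group_center special_linear_group"

lemma group_special_linear_group:
  "group (special_linear_group :: ('a::field ^ 'n ^ 'n) monoid)"
proof (rule groupI)
  fix A :: "'a ^ 'n ^ 'n"
  assume "A \<in> carrier special_linear_group"
  then have dA: "det A = 1"
    by (simp add: special_linear_group_def)
  then have "invertible A"
    by (simp add: invertible_det_nz)
  then obtain B where B: "B ** A = mat 1"
    by (auto simp: invertible_def)
  then have "det B * det A = 1"
    using det_mul[of B A] by simp
  with dA B show "\<exists>B \<in> carrier special_linear_group.
      B \<otimes>\<^bsub>special_linear_group\<^esub> A = \<one>\<^bsub>special_linear_group\<^esub>"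
    by (auto simp: special_linear_group_def)
qed (auto simp: special_linear_group_def det_mul matrix_mul_assoc)

lemma normal_group_center:
  assumes "group G"
  shows "group_center G \<lhd> G"
proof -
  interpret group G by fact
  have inv_comm: "inv\<^bsub>G\<^esub> z \<otimes>\<^bsub>G\<^esub> x = x \<otimes>\<^bsub>G\<^esub> inv\<^bsub>G\<^esub> z"
    if z: "z \<in> carrier G" and x: "x \<in> carrier G"
      and zx: "z \<otimes>\<^bsub>G\<^esub> x = x \<otimes>\<^bsub>G\<^esub> z" for x z
  proof -
    have "x = inv\<^bsub>G\<^esub> z \<otimes>\<^bsub>G\<^esub> (x \<otimes>\<^bsub>G\<^esub> z)"
      using z x by (simp add: zx[symmetric] m_assoc[symmetric])
    then have "x \<otimes>\<^bsub>G\<^esub> inv\<^bsub>G\<^esub> z = inv\<^bsub>G\<^esub> z \<otimes>\<^bsub>G\<^esub> (x \<otimes>\<^bsub>G\<^esub> z) \<otimes>\<^bsub>G\<^esub> inv\<^bsub>G\<^esub> z"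
      by simp
    also have "\<dots> = inv\<^bsub>G\<^esub> z \<otimes>\<^bsub>G\<^esub> x"
      using z x by (simp add: m_assoc)
    finally show ?thesis ..
  qed
  have mult_comm: "y \<otimes>\<^bsub>G\<^esub> z \<otimes>\<^bsub>G\<^esub> x = x \<otimes>\<^bsub>G\<^esub> (y \<otimes>\<^bsub>G\<^esub> z)"
    if "y \<in> group_center G" "z \<in> group_center G" "x \<in> carrier G" for x y z
  proof -
    have yz: "y \<in> carrier G" "z \<in> carrier G"
      and yx: "y \<otimes>\<^bsub>G\<^esub> x = x \<otimes>\<^bsub>G\<^esub> y"
      and zx: "z \<otimes>\<^bsub>G\<^esub> x = x \<otimes>\<^bsub>G\<^esub> z"
      using that unfolding group_center_def by blast+
    have "y \<otimes>\<^bsub>G\<^esub> z \<otimes>\<^bsub>G\<^esub> x = y \<otimes>\<^bsub>G\<^esub> x \<otimes>\<^bsub>G\<^esub> z"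
      by (simp only: m_assoc yz that(3) zx)
    also have "\<dots> = x \<otimes>\<^bsub>G\<^esub> (y \<otimes>\<^bsub>G\<^esub> z)"
      by (simp only: m_assoc yz that(3) yx)
    finally show ?thesis .
  qed
  have sub: "subgroup (group_center G) G"
  proof (rule subgroupI)
    show "group_center G \<noteq> {}"
      using one_closed by (fastforce simp: group_center_def)
  next
    fix y z assume "y \<in> group_center G" "z \<in> group_center G"
    then show "y \<otimes>\<^bsub>G\<^esub> z \<in> group_center G"
      using mult_comm[of y z] unfolding group_center_def by blast
  next
    fix z assume "z \<in> group_center G"
    then show "inv\<^bsub>G\<^esub> z \<in> group_center G"
      using inv_comm[of z] unfolding group_center_def by blast
  next
    show "group_center G \<subseteq> carrier G"
      unfolding group_center_def by blast
  qed
  have "x \<otimes>\<^bsub>G\<^esub> z \<otimes>\<^bsub>G\<^esub> inv\<^bsub>G\<^esub> x \<in> group_center G"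
    if "z \<in> group_center G" "x \<in> carrier G" for x z
  proof -
    have z: "z \<in> carrier G" and zx: "z \<otimes>\<^bsub>G\<^esub> x = x \<otimes>\<^bsub>G\<^esub> z"
      using that unfolding group_center_def by blast+
    have "x \<otimes>\<^bsub>G\<^esub> z \<otimes>\<^bsub>G\<^esub> inv\<^bsub>G\<^esub> x = z"
      unfolding zx[symmetric] using z that(2) by (simp add: m_assoc)
    with that(1) show ?thesis
      by simp
  qed
  with sub show ?thesis
    by (rule normal_invI)
qed

lemma group_projective_special_linear_group:
  "group (projective_special_linear_group :: ('a::field ^ 'n ^ 'n) set monoid)"
  unfolding projective_special_linear_group_def
  by (intro normal.factorgroup_is_group normal_group_center group_special_linear_group)

end

theory Submission
  imports Defs "HOL-Number_Theory.Residues" "HOL-Algebra.Algebraic_Closure_Type"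
begin

text \<open>
  The theorem is a form of 3/2-generation. For every noncentral $h$ in $SL(2,q)$ some $g$ in
  $SL(2,q)$ is such that $h$ and $g$ together generate $SL(2,q)$ (lemma \<open>SL2_partner\<close>). A nontrivial
  $H$ contains the class of such an $h$; a maximal subgroup containing $H$ and the class of $g$
  would then be the whole group, so the class of $g$ lies outside the maximal cover of $H$.

  The partner is found without any classification of subgroups. A nonscalar $h$ of trace $t$
  is conjugate to every matrix $M$ with rows $(a, b)$ and $(1, d)$, $a + d = t$ and $ad - b = 1$
  (\<open>similar_to_mat2\<close>), so $a$ is at our disposal. By a Bruhat argument it is enough that $M$ and
  $g$ generate all upper unipotent matrices (\<open>SL2_generated_by_unipotents\<close>).

  If $q$ is prime, one nontrivial upper unipotent $g$ has all the others as its powers. Otherwise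
  $q = 4$ or $q \<ge> 8$, and $g$ is diagonal with entries $w$, $1/w$ for a primitive element $w$ of the
  field, so that its powers form the full diagonal torus. The word
  $M \cdot \mathrm{diag}(x, 1/x) \cdot M \cdot \mathrm{diag}(y, 1/y) \cdot M$
  is upper triangular exactly when $(a x^2 + d)(a y^2 + d) = x^2$, and then it is not
  diagonal as long as $b \<noteq> 0$ and $x^2 \<noteq> y^2$. A torus element turns it into a nontrivial
  unipotent, conjugation by the torus scales the unipotent entry by squares, and differences of
  squares exhaust the field (\<open>SL2_generated_by_torus\<close>). It remains to solve the equation.
  For $t \<noteq> 0$ this is immediate with $d = 0$. For $t = 0$ it asks for $x$ and $y$ with
  $(x^2 - 1)(y^2 - 1)$ a nonzero square, which exist by the pigeonhole principle
  (\<open>exists_shifted_squares_product_square\<close>, \<open>torus_parameters\<close>).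
\<close>

section \<open>Two-by-two matrices\<close>

definition mat2 :: "'a \<Rightarrow> 'a \<Rightarrow> 'a \<Rightarrow> 'a \<Rightarrow> 'a::field ^ 2 ^ 2" where
  "mat2 a b c d = vector [vector [a, b], vector [c, d]]"

lemma mat2_nth [simp]:
  "mat2 a b c d $ 1 $ 1 = a" "mat2 a b c d $ 1 $ 2 = b"
  "mat2 a b c d $ 2 $ 1 = c" "mat2 a b c d $ 2 $ 2 = d"
  by (simp_all add: mat2_def)

lemma mat2_eta: "mat2 (A $ 1 $ 1) (A $ 1 $ 2) (A $ 2 $ 1) (A $ 2 $ 2) = A"
  by (simp add: vec_eq_iff forall_2)

lemma mat2_eq_iff [simp]:
  "mat2 a b c d = mat2 a' b' c' d' \<longleftrightarrow> a = a' \<and> b = b' \<and> c = c' \<and> d = d'"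
  by (auto simp: vec_eq_iff forall_2)

lemma mat2_mult [simp]:
  "mat2 a b c d ** mat2 a' b' c' d' =
     mat2 (a * a' + b * c') (a * b' + b * d') (c * a' + d * c') (c * b' + d * d')"
  by (simp add: vec_eq_iff forall_2 matrix_matrix_mult_def sum_2)

lemma det_mat2 [simp]: "det (mat2 a b c d) = a * d - b * c"
  by (simp add: det_2)

section \<open>Arithmetic in a finite field\<close>

text \<open>
  The trichotomy behind the construction: a prime field has a cyclic additive group, and
  the other fields have enough squares.
\<close>

lemma primepow_cases:
  assumes "primepow (q::nat)"
  shows "Factorial_Ring.prime q \<or> q = 4 \<or> q \<ge> 8"
proof -
  obtain p k where pk: "Factorial_Ring.prime p" "k > 0" "q = p ^ k"
    using assms by (auto simp: primepow_def)
  have p2: "p \<ge> 2"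
    using pk(1) by (rule prime_ge_2_nat)
  consider "k = 1" | "k = 2" | "k \<ge> 3"
    using pk(2) by linarith
  then show ?thesis
  proof cases
    case 1
    then show ?thesis
      using pk by simp
  next
    case 2
    show ?thesis
    proof (cases "p = 2")
      case False
      with p2 have "3 ^ 2 \<le> p ^ 2"
        by (intro power_mono) auto
      then show ?thesis
        using 2 pk by simp
    qed (use 2 pk in simp)
  next
    case 3
    have "(2::nat) ^ 3 \<le> 2 ^ k"
      using 3 by (intro power_increasing) auto
    also have "2 ^ k \<le> p ^ k"
      using p2 by (intro power_mono) auto
    finally show ?thesis
      using pk by simp
  qed
qed

lemma power2_inj_char_2:
  fixes x y :: "'a::field"
  assumes "(2::'a) = 0" "x\<^sup>2 = y\<^sup>2"
  shows "x = y"
proof -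
  have "x = y \<or> x = - y"
    using assms(2) by (simp add: power2_eq_iff)
  moreover have "- y = y"
    using assms(1) by (metis add_eq_0_iff mult_2 mult_zero_left)
  ultimately show ?thesis
    by auto
qed

lemma power2_surj_char_2:
  fixes z :: "'a::{field, finite}"
  assumes "(2::'a) = 0"
  shows "\<exists>x. z = x\<^sup>2"
proof -
  have "inj (\<lambda>x::'a. x\<^sup>2)"
    using power2_inj_char_2[OF assms] by (auto intro: injI)
  then have "surj (\<lambda>x::'a. x\<^sup>2)"
    by (simp add: finite_UNIV_inj_surj)
  then show ?thesis
    by (metis surjD)
qed

text \<open>
  In odd characteristic $z$ is the difference of the squares of $(z+1)/2$ and $(z-1)/2$; in
  characteristic two squaring is injective, hence onto.
\<close>

lemma difference_of_squares:
  fixes z :: "'a::{field, finite}"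
  shows "\<exists>x y. z = x\<^sup>2 - y\<^sup>2"
proof (cases "(2::'a) = 0")
  case True
  then obtain x where "z = x\<^sup>2"
    using power2_surj_char_2 by blast
  then have "z = x\<^sup>2 - 0\<^sup>2"
    by simp
  then show ?thesis
    by blast
next
  case False
  have "(z + 1) / 2 + (z - 1) / 2 = z" "(z + 1) / 2 - (z - 1) / 2 = 1"
    using False by (simp_all flip: add_divide_distrib diff_divide_distrib)
  then have "z = ((z + 1) / 2)\<^sup>2 - ((z - 1) / 2)\<^sup>2"
    by (metis mult_1 mult.commute square_diff_square_factored power2_eq_square)
  then show ?thesis
    by blast
qed

lemma of_nat_surj_prime_card:
  assumes "Factorial_Ring.prime (CARD('a::{field, finite}))"
  shows "\<exists>n. (z :: 'a) = of_nat n"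
proof -
  have "CHAR('a) dvd CARD('a)"
    by (rule CHAR_dvd_CARD)
  then have "CHAR('a) = CARD('a)"
    using assms by (metis CHAR_not_1' prime_nat_iff One_nat_def)
  then have "inj_on (of_nat :: nat \<Rightarrow> 'a) {..<CARD('a)}"
    by (auto simp: inj_on_def of_nat_eq_iff_cong_CHAR cong_def)
  then have "card ((of_nat :: nat \<Rightarrow> 'a) ` {..<CARD('a)}) = CARD('a)"
    by (simp add: card_image)
  then have "(of_nat :: nat \<Rightarrow> 'a) ` {..<CARD('a)} = UNIV"
    by (metis card_eq_UNIV_imp_eq_UNIV finite)
  then show ?thesis
    by (metis UNIV_I imageE)
qed

text \<open>
  Cyclicity of the multiplicative group. The last conjunct bounds the order of the generator
  below by counting: if $w^k = 1$, the powers of $w$ take at most $k$ values.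
\<close>

lemma finite_field_primitive_element:
  "\<exists>w::'a::{field, finite}. w \<noteq> 0 \<and> (\<forall>z. z \<noteq> 0 \<longrightarrow> (\<exists>n. z = w ^ n)) \<and>
     (\<forall>k. 0 < k \<longrightarrow> k < CARD('a) - 1 \<longrightarrow> w ^ k \<noteq> 1)"
proof -
  let ?R = "ring_of_type_algebra :: 'a ring"
  interpret R: field ?R
    by (rule field_from_type_algebra)
  have carrier_R: "carrier ?R = UNIV" and mult_R: "monoid.mult ?R = (*)"
    and one_R: "\<one>\<^bsub>?R\<^esub> = 1" and zero_R: "\<zero>\<^bsub>?R\<^esub> = 0"
    by (simp_all add: ring_of_type_algebra_def)
  have pow_R: "w [^]\<^bsub>?R\<^esub> (n::nat) = w ^ n" for w n
    by (induction n) (simp_all add: one_R mult_R mult.commute)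
  obtain w where "carrier (mult_of ?R) = {w [^]\<^bsub>?R\<^esub> i | i::nat. i \<in> UNIV}"
    using R.finite_field_mult_group_has_gen by (auto simp: carrier_R)
  then have gen: "UNIV - {0} = {w ^ i | i::nat. i \<in> UNIV}"
    by (simp add: carrier_R zero_R pow_R)
  have "w ^ 1 \<in> UNIV - {0}"
    unfolding gen by blast
  then have w: "w \<noteq> 0"
    by simp
  have gen': "\<exists>n. z = w ^ n" if "z \<noteq> 0" for z
    using gen that by blast
  have "w ^ k \<noteq> 1" if k: "0 < k" "k < CARD('a) - 1" for k
  proof
    assume wk: "w ^ k = 1"
    have "w ^ n = w ^ (n mod k)" for n
    proof -
      have "w ^ n = w ^ (k * (n div k) + n mod k)"
        by simp
      also have "\<dots> = w ^ (n mod k)"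
        by (simp only: power_add power_mult wk power_one mult_1)
      finally show ?thesis .
    qed
    then have "UNIV - {0} \<subseteq> (\<lambda>n. w ^ n) ` {..<k}"
      unfolding gen using k(1) by (auto intro!: image_eqI[where x = "_ mod k"])
    then have "card (UNIV - {0::'a}) \<le> k"
      by (metis card_lessThan finite_lessThan surj_card_le)
    with k(2) show False
      by (simp add: card_Diff_singleton)
  qed
  with w gen' show ?thesis
    by blast
qed

text \<open>
  Nonzero field elements fall into at most two classes modulo squares. For $q \<ge> 8$ the squares of $w$,
  $w^2$, $w^3$ are distinct and different from $1$, so among the three elements obtained by subtracting $1$
  two lie in the same class and have a square product. For $q = 4$ only $w^2$ and $w^4$ are
  available, but there every element is a square.
\<close>

lemma exists_shifted_squares_product_square:
  assumes "CARD('a::{field, finite}) = 4 \<or> CARD('a::{field, finite}) \<ge> 8"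
  obtains x y z :: "'a::{field, finite}" where "x \<noteq> 0" "y \<noteq> 0" "x\<^sup>2 \<noteq> 1" "y\<^sup>2 \<noteq> 1" "x\<^sup>2 \<noteq> y\<^sup>2"
    "(x\<^sup>2 - 1) * (y\<^sup>2 - 1) = z\<^sup>2"
proof -
  obtain w :: 'a where w: "w \<noteq> 0" and gen: "\<And>z. z \<noteq> 0 \<Longrightarrow> \<exists>n. z = w ^ n"
    and ord: "\<And>k. 0 < k \<Longrightarrow> k < CARD('a) - 1 \<Longrightarrow> w ^ k \<noteq> 1"
    using finite_field_primitive_element by blast
  show thesis
    using assms
  proof
    assume q: "CARD('a) = 4"
    have "CHAR('a) dvd 2 ^ 2"
      using CHAR_dvd_CARD[where 'a = 'a] q by simp
    moreover have "Factorial_Ring.prime (CHAR('a))"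
      by (simp add: prime_CHAR_semidom finite_imp_CHAR_pos)
    ultimately have "CHAR('a) dvd 2"
      by (rule prime_dvd_power[rotated])
    then have two: "(2::'a) = 0"
      by (metis of_nat_eq_0_iff_char_dvd of_nat_numeral)
    have w1: "w \<noteq> 1" "w\<^sup>2 \<noteq> 1"
      using ord[of 1] ord[of 2] q by simp_all
    then have "(w\<^sup>2)\<^sup>2 \<noteq> 1"
      using power2_inj_char_2[OF two, of "w\<^sup>2" 1] by auto
    moreover have "w\<^sup>2 \<noteq> (w\<^sup>2)\<^sup>2"
      using power2_inj_char_2[OF two, of w "w\<^sup>2"] w w1 by (auto simp: power2_eq_square)
    moreover obtain z where "(w\<^sup>2 - 1) * ((w\<^sup>2)\<^sup>2 - 1) = z\<^sup>2"
      using power2_surj_char_2[OF two] by blast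
    ultimately show thesis
      using w w1 by (intro that[of w "w\<^sup>2" z]) auto
  next
    assume q: "CARD('a) \<ge> 8"
    have pw1: "(w ^ i)\<^sup>2 \<noteq> 1" if "0 < i" "i \<le> 3" for i
      using ord[of "i * 2"] that q by (simp add: power_mult)
    have pw2: "(w ^ i)\<^sup>2 \<noteq> (w ^ j)\<^sup>2" if "i < j" "j \<le> 3" for i j
    proof
      assume "(w ^ i)\<^sup>2 = (w ^ j)\<^sup>2"
      moreover have "(w ^ j)\<^sup>2 = (w ^ i)\<^sup>2 * (w ^ (j - i))\<^sup>2"
        using that by (simp flip: power_mult_distrib power_add)
      ultimately show False
        using pw1[of "j - i"] that w by simp
    qed
    have "\<exists>n. (w ^ i)\<^sup>2 - 1 = w ^ n" if "0 < i" "i \<le> 3" for i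
      using pw1[OF that] by (intro gen) simp
    then obtain e where e: "\<And>i. 0 < i \<Longrightarrow> i \<le> 3 \<Longrightarrow> (w ^ i)\<^sup>2 - 1 = w ^ e i"
      by metis
    have "\<exists>i j. 0 < i \<and> i < j \<and> j \<le> 3 \<and> even (e i + e j)"
    proof (rule ccontr)
      assume "\<not> ?thesis"
      then have "odd (e i + e j)" if "0 < i" "i < j" "j \<le> 3" for i j
        using that by blast
      from this[of 1 2] this[of 1 3] this[of 2 3] show False
        by auto
    qed
    then obtain i j where ij: "0 < i" "i < j" "j \<le> 3" "even (e i + e j)"
      by blast
    then obtain m where "e i + e j = m * 2"
      by (metis dvd_def mult.commute)
    then have "((w ^ i)\<^sup>2 - 1) * ((w ^ j)\<^sup>2 - 1) = (w ^ m)\<^sup>2"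
      using ij e[of i] e[of j] by (simp flip: power_add power_mult)
    then show thesis
      using ij w pw1[of i] pw1[of j] pw2[of i j] by (intro that[of "w ^ i" "w ^ j" "w ^ m"]) auto
  qed
qed

text \<open>
  With $d = 0$ the equation reads $a^2 y^2 = 1$, so $a = t$ and $y = 1/t$ work when $t \<noteq> 0$. If
  $t = 0$, then $d = -a$ and the equation becomes $a^2 (x^2-1)(y^2-1) = x^2$, solved by $a = x/z$ with
  $z$ a square root of $(x^2-1)(y^2-1)$.
\<close>

lemma torus_parameters:
  fixes t :: "'a::{field, finite}"
  assumes q: "CARD('a) = 4 \<or> CARD('a) \<ge> 8"
  obtains a d x y :: 'a where "a + d = t" "a * d \<noteq> 1" "x \<noteq> 0" "y \<noteq> 0" "x\<^sup>2 \<noteq> y\<^sup>2"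
    "(a * x\<^sup>2 + d) * (a * y\<^sup>2 + d) = x\<^sup>2"
proof -
  obtain x y z :: 'a where x: "x \<noteq> 0" "x\<^sup>2 \<noteq> 1" and y: "y \<noteq> 0" "y\<^sup>2 \<noteq> 1" and xy: "x\<^sup>2 \<noteq> y\<^sup>2"
    and z: "(x\<^sup>2 - 1) * (y\<^sup>2 - 1) = z\<^sup>2"
    by (rule exists_shifted_squares_product_square[OF q])
  show thesis
  proof (cases "t = 0")
    case False
    \<comment> \<open>\<open>x\<close> is reused only as an element whose square differs from \<open>1\<close>.\<close>
    have "(x / t)\<^sup>2 \<noteq> (1 / t)\<^sup>2"
      using x False by (simp add: power_divide)
    then show thesis
      using x False by (intro that[of t 0 "x / t" "1 / t"]) (auto simp: power2_eq_square)
  next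
    case True
    have z0: "z \<noteq> 0"
      using z x y by auto
    note result = that
    have factor: "(e * U + - e) * (e * V + - e) = e\<^sup>2 * ((U - 1) * (V - 1))" for e U V :: 'a
      by (simp add: algebra_simps power2_eq_square)
    have *: thesis if "u \<noteq> 0" "v \<noteq> 0" "u\<^sup>2 \<noteq> v\<^sup>2" "(u\<^sup>2 - 1) * (v\<^sup>2 - 1) = z\<^sup>2" "- (u / z)\<^sup>2 \<noteq> 1"
      for u v
    proof (rule result[of "u / z" "- (u / z)" u v])
      have "(u / z * u\<^sup>2 + - (u / z)) * (u / z * v\<^sup>2 + - (u / z)) = (u / z)\<^sup>2 * ((u\<^sup>2 - 1) * (v\<^sup>2 - 1))"
        using factor .
      also have "\<dots> = u\<^sup>2"
        unfolding that(4) using z0 by (simp add: power_divide)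
      finally show "(u / z * u\<^sup>2 + - (u / z)) * (u / z * v\<^sup>2 + - (u / z)) = u\<^sup>2" .
    qed (use that True in \<open>auto simp: power2_eq_square\<close>)
    \<comment> \<open>Here \<open>a * d = - a\<^sup>2\<close>. Should this be \<open>1\<close>, exchanging \<open>x\<close> and \<open>y\<close> changes \<open>a\<^sup>2\<close> and repairs it.\<close>
    have "(x / z)\<^sup>2 \<noteq> (y / z)\<^sup>2"
      using xy z0 by (simp add: power_divide)
    then have "- (x / z)\<^sup>2 \<noteq> 1 \<or> - (y / z)\<^sup>2 \<noteq> 1"
      by (metis minus_equation_iff)
    then show thesis
      using *[of x y] *[of y x] x y xy z by (auto simp: mult.commute)
  qed
qed

section \<open>Generating the special linear group\<close>

text \<open>
  Multiplying $M$ by upper unipotents on both sides changes its diagonal entries at will, so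
  $L$ contains every matrix of determinant $1$ with lower left entry $1$. Products of two of these
  realise every nonzero lower left entry $c$, and upper triangular matrices are products of
  two matrices with nonzero lower left entry.
\<close>

lemma SL2_generated_by_unipotents:
  fixes L :: "('a::field ^ 2 ^ 2) set"
  assumes closed: "\<And>A B. A \<in> L \<Longrightarrow> B \<in> L \<Longrightarrow> A ** B \<in> L"
    and U: "\<And>r. mat2 1 r 0 1 \<in> L"
    and M: "mat2 a b 1 d \<in> L" and det_M: "a * d - b = 1"
    and det_A: "det A = 1"
  shows "A \<in> L"
proof -
  have c1: "mat2 a' (a' * d' - 1) 1 d' \<in> L" for a' d'
  proof -
    have "mat2 1 (a' - a) 0 1 ** mat2 a b 1 d ** mat2 1 (d' - d) 0 1 = mat2 a' (a' * d' - 1) 1 d'"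
      using det_M by (simp add: algebra_simps)
    then show ?thesis
      by (metis U M closed)
  qed
  have c_nz: "mat2 p q c s \<in> L" if "c \<noteq> 0" "p * s - q * c = 1" for p q c s
  proof -
    \<comment> \<open>Solves \<open>mat2 p q c s = mat2 f (-1) 1 0 ** mat2 c (c * e - 1) 1 e\<close> for the two free parameters.\<close>
    define e where "e = (s + 1) / c"
    define f where "f = (p + 1) / c"
    have ef: "c * e = s + 1" "c * f = p + 1"
      using that(1) by (simp_all add: e_def f_def)
    have "c * (f * s - e) = p * s - 1"
      using ef by (simp add: right_diff_distrib algebra_simps flip: mult.assoc)
    also have "\<dots> = c * q"
      using that(2) by (simp add: algebra_simps)
    finally have "f * s - e = q"
      using that(1) by simp
    then have "mat2 p q c s = mat2 f (f * 0 - 1) 1 0 ** mat2 c (c * e - 1) 1 e"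
      using ef by (simp add: mult.commute)
    then show ?thesis
      by (simp only: c1 closed)
  qed
  have "mat2 p q c s \<in> L" if "p * s - q * c = 1" for p q c s
  proof (cases "c = 0")
    case True
    then have "s \<noteq> 0" "mat2 p q c s = mat2 (-q) p (-s) 0 ** mat2 0 (-1) 1 0"
      using that by auto
    moreover have "mat2 (-q) p (-s) 0 \<in> L"
      using True that \<open>s \<noteq> 0\<close> by (intro c_nz) (auto simp: algebra_simps)
    moreover have "mat2 0 (-1) 1 0 \<in> L"
      by (intro c_nz) auto
    ultimately show ?thesis
      by (simp only: closed)
  qed (use c_nz that in blast)
  then have "mat2 (A $ 1 $ 1) (A $ 1 $ 2) (A $ 2 $ 1) (A $ 2 $ 2) \<in> L"
    using det_A by (simp add: det_2)
  then show ?thesis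
    by (simp only: mat2_eta)
qed

text \<open>
  The word $w$ below gives a first unipotent element. Its two off-diagonal entries differ by more
  than the factor $b$ because the word is not a palindrome: reversing it exchanges $x$ and $y$, so the
  lower left entry can vanish while the upper right one does not.
\<close>

lemma SL2_generated_by_torus:
  fixes L :: "('a::{field, finite} ^ 2 ^ 2) set"
  assumes closed: "\<And>A B. A \<in> L \<Longrightarrow> B \<in> L \<Longrightarrow> A ** B \<in> L"
    and D: "\<And>y. y \<noteq> 0 \<Longrightarrow> mat2 y 0 0 (1 / y) \<in> L"
    and M: "mat2 a b 1 d \<in> L" and det_M: "a * d - b = 1"
    and b: "b \<noteq> 0"
    and x: "x \<noteq> 0" and y: "y \<noteq> 0" and xy: "x\<^sup>2 \<noteq> y\<^sup>2"
    and eq: "(a * x\<^sup>2 + d) * (a * y\<^sup>2 + d) = x\<^sup>2"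
    and det_A: "det A = 1"
  shows "A \<in> L"
proof -
  define w where "w = mat2 a b 1 d ** mat2 x 0 0 (1 / x) ** mat2 a b 1 d
    ** mat2 y 0 0 (1 / y) ** mat2 a b 1 d"
  have w_L: "w \<in> L"
    unfolding w_def using M D x y by (intro closed)
  have det_w: "det w = 1"
    unfolding w_def det_mul using det_M x y by simp
  have b_eq: "b = a * d - 1"
    using det_M by (simp add: algebra_simps)
  have "w $ 2 $ 1 * (x * y) = (a * x\<^sup>2 + d) * (a * y\<^sup>2 + d) - x\<^sup>2"
    using x y unfolding w_def b_eq
    by (simp add: field_simps power2_eq_square)
  then have w21: "w $ 2 $ 1 = 0"
    using eq x y by simp
  have "w $ 1 $ 2 * (x * y) = b * ((a * y\<^sup>2 + d) * (a * x\<^sup>2 + d) - y\<^sup>2)"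
    using x y unfolding w_def b_eq
    by (simp add: field_simps power2_eq_square)
  also have "\<dots> = b * (x\<^sup>2 - y\<^sup>2)"
    using eq by (simp add: mult.commute)
  finally have w12: "w $ 1 $ 2 \<noteq> 0"
    using b x y xy by auto
  define p where "p = w $ 1 $ 1"
  define r where "r = w $ 1 $ 2 * p"
  have w_eq: "w = mat2 p (w $ 1 $ 2) 0 (w $ 2 $ 2)"
    by (metis mat2_eta p_def w21)
  have pw: "p * w $ 2 $ 2 = 1"
    using det_w w21 by (simp add: det_2 p_def)
  then have p: "p \<noteq> 0"
    by auto
  have "w ** mat2 (1 / p) 0 0 (1 / (1 / p)) = mat2 1 r 0 1"
    using p pw by (subst w_eq) (simp add: r_def mult.commute)
  then have r_L: "mat2 1 r 0 1 \<in> L"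
    using w_L D p by (metis closed divide_eq_0_iff one_neq_zero)
  have r: "r \<noteq> 0"
    using w12 p by (simp add: r_def)
  \<comment> \<open>The entries of the upper unipotents in \<open>L\<close>: an additive group stable under multiplication by squares.\<close>
  define R where "R = {s. mat2 1 s 0 1 \<in> L}"
  have R_add: "s + t \<in> R" if "s \<in> R" "t \<in> R" for s t
    using closed[of "mat2 1 s 0 1" "mat2 1 t 0 1"] that by (simp add: R_def add.commute)
  have R_square: "z\<^sup>2 * s \<in> R" if "s \<in> R" for s z
  proof (cases "z = 0")
    case True
    have "mat2 1 0 0 1 \<in> L"
      using D[of 1] by simp
    with True show ?thesis
      by (simp add: R_def)
  next
    case False
    then have "mat2 z 0 0 (1 / z) ** mat2 1 s 0 1 ** mat2 (1 / z) 0 0 (1 / (1 / z))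
        = mat2 1 (z\<^sup>2 * s) 0 1"
      by (simp add: power2_eq_square)
    then show ?thesis
      using closed D False that unfolding R_def
      by (metis divide_eq_0_iff mem_Collect_eq one_neq_zero)
  qed
  \<comment> \<open>Closure of \<open>R\<close> under negation comes from finite characteristic: \<open>- s\<close> is a multiple of \<open>s\<close>.\<close>
  have R_scale: "of_nat n * s \<in> R" if "s \<in> R" for n s
  proof (induction n)
    case 0
    show ?case
      using R_square[OF that, of 0] by simp
  next
    case (Suc n)
    then show ?case
      using R_add[OF that Suc] by (simp add: algebra_simps)
  qed
  have R_minus: "- s \<in> R" if "s \<in> R" for s
  proof -
    have "CHAR('a) > 0"
      by (simp add: finite_imp_CHAR_pos)
    then have "(of_nat (CHAR('a) - 1) :: 'a) = - 1"
      by (simp add: of_nat_diff)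
    then show ?thesis
      using R_scale[OF that, of "CHAR('a) - 1"] by simp
  qed
  have "mat2 1 s 0 1 \<in> L" for s
  proof -
    obtain u v where uv: "s / r = u\<^sup>2 - v\<^sup>2"
      using difference_of_squares by blast
    have "u\<^sup>2 * r + - (v\<^sup>2 * r) \<in> R"
      using r_L by (intro R_add R_minus R_square) (simp_all add: R_def)
    also have "u\<^sup>2 * r + - (v\<^sup>2 * r) = (s / r) * r"
      unfolding uv by (simp add: algebra_simps)
    finally show ?thesis
      using r by (simp add: R_def)
  qed
  then show ?thesis
    using SL2_generated_by_unipotents[OF closed _ M det_M det_A] by blast
qed

section \<open>Every noncentral matrix has a generating partner\<close>

text \<open>
  Only closure under products is required: in a finite group inverses are powers, so for
  matrices of determinant $1$ over a finite field this is generation as a group.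
\<close>

definition generate_SL2 :: "'a::field ^ 2 ^ 2 \<Rightarrow> 'a ^ 2 ^ 2 \<Rightarrow> bool" where
  "generate_SL2 h g \<longleftrightarrow> (\<forall>L. h \<in> L \<longrightarrow> g \<in> L \<longrightarrow> (\<forall>A\<in>L. \<forall>B\<in>L. A ** B \<in> L) \<longrightarrow> {A. det A = 1} \<subseteq> L)"

lemma generate_SL2I:
  assumes "\<And>L A. (\<And>A B. A \<in> L \<Longrightarrow> B \<in> L \<Longrightarrow> A ** B \<in> L) \<Longrightarrow> h \<in> L \<Longrightarrow> g \<in> L \<Longrightarrow> det A = 1 \<Longrightarrow> A \<in> L"
  shows "generate_SL2 h g"
  unfolding generate_SL2_def using assms by blast

lemma generate_SL2D:
  assumes "generate_SL2 h g" "\<And>A B. A \<in> L \<Longrightarrow> B \<in> L \<Longrightarrow> A ** B \<in> L" "h \<in> L" "g \<in> L" "det A = 1"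
  shows "A \<in> L"
  using assms unfolding generate_SL2_def by blast

text \<open>
  For each trace there is a representative $M$ of the form used above together with a partner:
  a unipotent matrix over a prime field, a generator of the diagonal torus otherwise.
\<close>

lemma mat2_partner:
  fixes t :: "'a::{field, finite}"
  assumes "primepow CARD('a)"
  obtains a b d g where "a + d = t" "a * d - b = 1" "det g = 1" "generate_SL2 (mat2 a b 1 d) g"
proof (cases "Factorial_Ring.prime (CARD('a))")
  case True
  have gen: "generate_SL2 (mat2 0 (-1) 1 t) (mat2 1 1 0 1)"
  proof (rule generate_SL2I)
    fix L and A :: "'a ^ 2 ^ 2"
    assume closed: "\<And>A B. A \<in> L \<Longrightarrow> B \<in> L \<Longrightarrow> A ** B \<in> L"
      and M: "mat2 0 (-1) 1 t \<in> L" and u: "mat2 1 1 0 1 \<in> L" and det_A: "det A = 1"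
    have n: "mat2 1 (of_nat (Suc n)) 0 1 \<in> L" for n
    proof (induction n)
      case (Suc n)
      then show ?case
        using closed[OF u Suc] by (simp add: algebra_simps)
    qed (use u in simp)
    have "mat2 1 r 0 1 \<in> L" for r
    proof -
      obtain n where "r - 1 = of_nat n"
        using of_nat_surj_prime_card[OF True] by blast
      then have "r = of_nat (Suc n)"
        by (simp add: algebra_simps)
      with n show ?thesis
        by metis
    qed
    then show "A \<in> L"
      using SL2_generated_by_unipotents[OF closed _ M _ det_A] by simp
  qed
  show thesis
    by (rule that[OF _ _ _ gen]) auto
next
  case False
  then have q: "CARD('a) = 4 \<or> CARD('a) \<ge> 8"
    using primepow_cases[OF assms] by auto
  obtain w :: 'a where w: "w \<noteq> 0" and gen: "\<And>z. z \<noteq> 0 \<Longrightarrow> \<exists>n. z = w ^ n"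
    using finite_field_primitive_element by blast
  obtain a d x y :: 'a where par: "a + d = t" "a * d \<noteq> 1" "x \<noteq> 0" "y \<noteq> 0" "x\<^sup>2 \<noteq> y\<^sup>2"
    "(a * x\<^sup>2 + d) * (a * y\<^sup>2 + d) = x\<^sup>2"
    by (rule torus_parameters[OF q])
  have "generate_SL2 (mat2 a (a * d - 1) 1 d) (mat2 w 0 0 (1 / w))"
  proof (rule generate_SL2I)
    fix L and A :: "'a ^ 2 ^ 2"
    assume closed: "\<And>A B. A \<in> L \<Longrightarrow> B \<in> L \<Longrightarrow> A ** B \<in> L"
      and M: "mat2 a (a * d - 1) 1 d \<in> L" and g: "mat2 w 0 0 (1 / w) \<in> L"
      and det_A: "det A = 1"
    have n: "mat2 (w ^ Suc n) 0 0 (1 / w ^ Suc n) \<in> L" for n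
    proof (induction n)
      case (Suc n)
      then show ?case
        using closed[OF g Suc] by (simp add: algebra_simps)
    qed (use g in simp)
    have D: "mat2 z 0 0 (1 / z) \<in> L" if z: "z \<noteq> 0" for z
    proof -
      obtain m where "z / w = w ^ m"
        using gen[of "z / w"] z w by auto
      then have "z = w ^ Suc m"
        using w by (simp add: field_simps)
      with n show ?thesis
        by metis
    qed
    show "A \<in> L"
      by (rule SL2_generated_by_torus[OF closed D M _ _ par(3-6) det_A]) (use par in auto)
  qed
  then show thesis
    by (rule that[rotated 3]) (use par w in auto)
qed

text \<open>
  A nonscalar $h$ has a vector $v$ for which $v$ and $hv$ are independent; one of the two
  coordinate vectors and their sum will do. In the basis $v$, $hv - av$ the matrix of $h$ has first column
  $(a, 1)$, and the trace and determinant determine the second one.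
\<close>

lemma similar_to_mat2:
  fixes h :: "'a::field ^ 2 ^ 2"
  assumes nonscalar: "\<not> (h $ 1 $ 2 = 0 \<and> h $ 2 $ 1 = 0 \<and> h $ 1 $ 1 = h $ 2 $ 2)"
    and tr: "a + d = h $ 1 $ 1 + h $ 2 $ 2" and det_M: "a * d - b = det h"
  obtains P Q where "P ** Q = mat 1" "Q ** P = mat 1" "h ** P = P ** mat2 a b 1 d"
proof -
  obtain p q r s where h: "h = mat2 p q r s"
    by (metis mat2_eta)
  obtain v1 v2 where v: "v1 * (r * v1 + s * v2) - (p * v1 + q * v2) * v2 \<noteq> 0"
  proof -
    consider "r \<noteq> 0" | "q \<noteq> 0" | "r = 0" "q = 0" "s - p \<noteq> 0"
      using nonscalar by (auto simp: h)
    then show thesis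
    proof cases
      case 1
      then show thesis
        using that[of 1 0] by simp
    next
      case 2
      then show thesis
        using that[of 0 1] by simp
    next
      case 3
      then show thesis
        using that[of 1 1] by simp
    qed
  qed
  define P where "P = mat2 v1 (p * v1 + q * v2 - a * v1) v2 (r * v1 + s * v2 - a * v2)"
  have "det P \<noteq> 0"
    using v by (simp add: P_def algebra_simps)
  then obtain Q where Q: "P ** Q = mat 1" "Q ** P = mat 1"
    by (metis invertible_def invertible_det_nz)
  have d_eq: "d = p + s - a"
    using tr by (simp add: h algebra_simps)
  have b_eq: "b = a * (p + s - a) - (p * s - q * r)"
    using det_M unfolding h d_eq by (simp add: algebra_simps)
  have "h ** P = P ** mat2 a b 1 d"
    unfolding h P_def b_eq d_eq by (simp add: algebra_simps)
  with Q show thesis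
    by (rule that)
qed

lemma SL2_partner:
  fixes h :: "'a::{field, finite} ^ 2 ^ 2"
  assumes q: "primepow CARD('a)" and det_h: "det h = 1"
    and nonscalar: "\<not> (h $ 1 $ 2 = 0 \<and> h $ 2 $ 1 = 0 \<and> h $ 1 $ 1 = h $ 2 $ 2)"
  obtains g where "det g = 1" "generate_SL2 h g"
proof -
  obtain a b d g where tr: "a + d = h $ 1 $ 1 + h $ 2 $ 2" and det_M: "a * d - b = 1"
    and det_g: "det g = 1"
    and gen: "generate_SL2 (mat2 a b 1 d) g"
    by (rule mat2_partner[OF q, of "h $ 1 $ 1 + h $ 2 $ 2"])
  obtain P Q where P: "P ** Q = mat 1" "Q ** P = mat 1" and hP: "h ** P = P ** mat2 a b 1 d"
    using similar_to_mat2[OF nonscalar tr] det_M det_h by auto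
  have det_PQ: "det P * det Q = 1"
    using P(1) by (metis det_I det_mul)
  have "generate_SL2 h (P ** g ** Q)"
  proof (rule generate_SL2I)
    fix L and A :: "'a ^ 2 ^ 2"
    assume closed: "\<And>A B. A \<in> L \<Longrightarrow> B \<in> L \<Longrightarrow> A ** B \<in> L"
      and h: "h \<in> L" and g: "P ** g ** Q \<in> L" and det_A: "det A = 1"
    \<comment> \<open>Generation is transported along conjugation by \<open>P\<close>.\<close>
    define L' where "L' = {B. P ** B ** Q \<in> L}"
    have "P ** (A ** B) ** Q = (P ** A ** Q) ** (P ** B ** Q)" for A B :: "'a ^ 2 ^ 2"
    proof -
      have "(P ** A ** Q) ** (P ** B ** Q) = P ** A ** (Q ** P) ** B ** Q"
        by (simp only: matrix_mul_assoc)
      then show ?thesis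
        by (simp add: P matrix_mul_assoc)
    qed
    then have "A ** B \<in> L'" if "A \<in> L'" "B \<in> L'" for A B
      using closed that by (simp add: L'_def)
    moreover have "mat2 a b 1 d \<in> L'"
    proof -
      have "P ** mat2 a b 1 d ** Q = h ** (P ** Q)"
        by (simp only: hP[symmetric] matrix_mul_assoc)
      then show ?thesis
        using h by (simp add: P L'_def)
    qed
    moreover have "g \<in> L'"
      using g by (simp add: L'_def)
    moreover have "det (Q ** A ** P) = 1"
      using det_PQ det_A by (simp add: det_mul mult.commute)
    ultimately have "Q ** A ** P \<in> L'"
      by (rule generate_SL2D[OF gen])
    then have "(P ** Q) ** A ** (P ** Q) \<in> L"
      by (simp add: L'_def matrix_mul_assoc)
    then show "A \<in> L"
      by (simp add: P)
  qed
  moreover have "det (P ** g ** Q) = 1"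
    using det_PQ det_g by (simp add: det_mul)
  ultimately show thesis
    using that by blast
qed

section \<open>Nontrivial subgroups of the projective special linear group\<close>

lemma scalar_in_center_SL2:
  fixes h :: "'a::field ^ 2 ^ 2"
  assumes "det h = 1" "h $ 1 $ 2 = 0" "h $ 2 $ 1 = 0" "h $ 1 $ 1 = h $ 2 $ 2"
  shows "h \<in> group_center special_linear_group"
proof -
  have "h ** x = x ** h" for x :: "'a ^ 2 ^ 2"
    using assms by (simp add: vec_eq_iff forall_2 matrix_matrix_mult_def sum_2 mult.commute)
  then show ?thesis
    using assms(1) by (simp add: group_center_def special_linear_group_def)
qed

theorem theorem3p4:
  fixes q :: nat and H :: "('a::{field, finite} ^ 2 ^ 2) set set"
  assumes "primepow q"
    and "CARD('a) = q"
    and "subgroup H (projective_special_linear_group :: ('a ^ 2 ^ 2) set monoid)"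
    and "H \<noteq> {\<one>\<^bsub>(projective_special_linear_group :: ('a ^ 2 ^ 2) set monoid)\<^esub>}"
    and "H \<noteq> carrier (projective_special_linear_group :: ('a ^ 2 ^ 2) set monoid)"
  shows "FF_subgroup H (projective_special_linear_group :: ('a ^ 2 ^ 2) set monoid)"
proof -
  let ?S = "special_linear_group :: ('a ^ 2 ^ 2) monoid"
  let ?Z = "group_center ?S"
  let ?G = "projective_special_linear_group :: ('a ^ 2 ^ 2) set monoid"
  interpret N: normal ?Z ?S
    by (intro normal_group_center group_special_linear_group)
  have carrier_S: "A \<in> carrier ?S \<longleftrightarrow> det A = 1" and mult_S: "A \<otimes>\<^bsub>?S\<^esub> B = A ** B" for A B :: "'a ^ 2 ^ 2"
    by (simp_all add: special_linear_group_def)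
  have carrier_G: "carrier ?G = {?Z #>\<^bsub>?S\<^esub> A | A. det A = 1}"
    by (auto simp: projective_special_linear_group_def FactGroup_def RCOSETS_def carrier_S)
  have coset_mult: "(?Z #>\<^bsub>?S\<^esub> A) \<otimes>\<^bsub>?G\<^esub> (?Z #>\<^bsub>?S\<^esub> B) = ?Z #>\<^bsub>?S\<^esub> (A ** B)"
    if "det A = 1" "det B = 1" for A B :: "'a ^ 2 ^ 2"
    using N.rcos_sum[of A B] that
    by (simp add: projective_special_linear_group_def FactGroup_def carrier_S mult_S)
  have one_G: "\<one>\<^bsub>?G\<^esub> = ?Z"
    by (simp add: projective_special_linear_group_def FactGroup_def)
  have "?Z \<in> H"
    using subgroup.one_closed[OF assms(3)] by (simp only: one_G)
  with assms(4) obtain C where C: "C \<in> H" "C \<noteq> ?Z"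
    unfolding one_G by blast
  then obtain h where h: "det h = 1" "C = ?Z #>\<^bsub>?S\<^esub> h"
    using subgroup.subset[OF assms(3)] by (auto simp: carrier_G)
  have "h \<notin> ?Z"
    using C h N.rcos_const by auto
  then have nonscalar: "\<not> (h $ 1 $ 2 = 0 \<and> h $ 2 $ 1 = 0 \<and> h $ 1 $ 1 = h $ 2 $ 2)"
    using scalar_in_center_SL2 h(1) by blast
  obtain g where det_g: "det g = 1"
    and gen: "generate_SL2 h g"
    using SL2_partner[OF _ h(1) nonscalar] assms(1,2) by blast
  have "?Z #>\<^bsub>?S\<^esub> g \<notin> maximal_cover ?G H"
  proof
    assume "?Z #>\<^bsub>?S\<^esub> g \<in> maximal_cover ?G H"
    then obtain K where K: "subgroup K ?G" "K \<noteq> carrier ?G" "H \<subseteq> K" "?Z #>\<^bsub>?S\<^esub> g \<in> K"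
      by (auto simp: maximal_cover_def maximal_subgroup_def)
    \<comment> \<open>The preimage of \<open>K\<close> in the special linear group.\<close>
    define L where "L = {A. det A = 1 \<and> ?Z #>\<^bsub>?S\<^esub> A \<in> K}"
    have "A ** B \<in> L" if "A \<in> L" "B \<in> L" for A B
      using subgroup.m_closed[OF K(1)] that coset_mult[of A B] by (fastforce simp: L_def det_mul)
    moreover have "h \<in> L" "g \<in> L"
      using C h K det_g by (auto simp: L_def)
    ultimately have "A \<in> L" if "det A = 1" for A
      using generate_SL2D[OF gen] that by blast
    then have "carrier ?G \<subseteq> K"
      by (auto simp: carrier_G L_def)
    with K(1,2) show False
      using subgroup.subset by blast
  qed
  moreover have "?Z #>\<^bsub>?S\<^esub> g \<in> carrier ?G"
    using det_g by (auto simp: carrier_G)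
  ultimately show ?thesis
    using assms(3,5) by (auto simp: FF_subgroup_def)
qed

end
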